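(* Let $C_3\in(0,1)$ be the absolute constant fixed in the context and let $\nu:=-\log_3(C_3)>0$. (i) For every $\epsilon>0$ there exists $N=N(\epsilon)$ such that for all positive integers $n,\ell$ with $n\ge N$, $\ell\geq N$ and $n-\ell\geq N$, every prime $p>\frac{4n}{\epsilon}$, and every set $A=\{v_1,\dots,v_n\}$ of $n$ distinct elements of $\mathbb{Z}_p$, if $X$ is chosen uniformly at random among the subsets of $A$ of size $\ell$, then $$\max_{x\in \mathbb{Z}_p} \mathbb{P}\Big[\sum_{v\in X} v=x\Big]\leq\frac{\epsilon}{n}.$$ (ii) In particular, if $\epsilon=2\left(\frac{3}{\ell_0}\right)^{\nu}$ for a positive integer $\ell_0$, then the same conclusion $\max_{x\in \mathbb{Z}_p} \mathbb{P}[\sum_{v\in X} v=x]\leq\frac{\epsilon}{n}$ holds whenever $\ell>\ell_0$, $n-\ell>\ell_0$, $p$ is a prime with $p>n^2$, and $n$ is sufficiently large with respect to $\ell_0$.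
   Context: $\mathbb{Z}_p$ is the cyclic group of prime order $p$. The constant $C_3\in(0,1)$ is a fixed absolute constant having the following property: for every real $0<\lambda\leq\frac{9}{10}$, every prime $p>\frac{2}{\lambda}$, and all i.i.d. $\mathbb{Z}_p$-valued random variables $Y_1,Y_2,Y_3$ with $\max_{x\in\mathbb{Z}_p}\mathbb{P}[Y_1=x]\leq\lambda$, one has $\max_{x\in\mathbb{Z}_p}\mathbb{P}[Y_1+Y_2+Y_3=x]\leq C_3\lambda$. (The existence of such a constant is a separate result and may be assumed.) *)

theory Defs
  imports "HOL-Probability.Probability" "HOL-Number_Theory.Residues"
begin

abbreviation Zp :: "nat \<Rightarrow> int ring"
  where "Zp p \<equiv> residue_ring (int p)"

definition max_prob :: "nat \<Rightarrow> 'a measure \<Rightarrow> ('a \<Rightarrow> int) \<Rightarrow> real"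
  where "max_prob p M Y = (MAX x\<in>carrier (Zp p). measure M {\<omega> \<in> space M. Y \<omega> = x})"

definition iid_Zp :: "nat \<Rightarrow> 'a measure \<Rightarrow> 'i set \<Rightarrow> ('i \<Rightarrow> 'a \<Rightarrow> int) \<Rightarrow> bool"
  where "iid_Zp p M I Y \<longleftrightarrow>
    prob_space.indep_vars M (\<lambda>_. count_space (carrier (Zp p))) Y I \<and>
    (\<forall>i\<in>I. \<forall>j\<in>I. distr M (count_space (carrier (Zp p))) (Y i)
                = distr M (count_space (carrier (Zp p))) (Y j))"

(* A formula cannot quantify over types, so a sample-space type is fixed here. This loses no
   generality: functions nat => int carry every joint law of three integer-valued random
   variables, and the lemma below recovers the property over arbitrary probability spaces. *)
definition three_sum_constant :: "real \<Rightarrow> bool"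
  where "three_sum_constant C \<longleftrightarrow>
    (\<forall>(lam::real) (p::nat) (M::(nat \<Rightarrow> int) measure) (Y::nat \<Rightarrow> (nat \<Rightarrow> int) \<Rightarrow> int).
      0 < lam \<longrightarrow> lam \<le> 9/10 \<longrightarrow> prime p \<longrightarrow> real p > 2 / lam \<longrightarrow>
      prob_space M \<longrightarrow> iid_Zp p M {1,2,3} Y \<longrightarrow> max_prob p M (Y 1) \<le> lam \<longrightarrow>
      max_prob p M (\<lambda>\<omega>. Y 1 \<omega> \<oplus>\<^bsub>Zp p\<^esub> Y 2 \<omega> \<oplus>\<^bsub>Zp p\<^esub> Y 3 \<omega>) \<le> C * lam)"

lemma three_sum_constant_any_space:
  fixes M :: "'b measure" and Y :: "nat \<Rightarrow> 'b \<Rightarrow> int"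
  assumes C: "three_sum_constant C"
    and lam: "0 < lam" "lam \<le> 9/10" and p: "prime p" "real p > 2 / lam"
    and M: "prob_space M" and iid: "iid_Zp p M {1,2,3} Y"
    and mx: "max_prob p M (Y 1) \<le> lam"
  shows "max_prob p M (\<lambda>\<omega>. Y 1 \<omega> \<oplus>\<^bsub>Zp p\<^esub> Y 2 \<omega> \<oplus>\<^bsub>Zp p\<^esub> Y 3 \<omega>) \<le> C * lam"
proof -
  interpret prob_space M by fact
  define I where "I = {1,2,3::nat}"
  define Z where "Z = count_space (carrier (Zp p))"
  define P where "P = PiM I (\<lambda>_. Z)"
  define F where "F = (\<lambda>\<omega>. \<lambda>i\<in>I. Y i \<omega>)"
  define N where "N = distr M P F"
  have indep: "indep_vars (\<lambda>_. Z) Y I"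
    using iid by (simp add: iid_Zp_def I_def Z_def)
  have same: "distr M Z (Y i) = distr M Z (Y j)" if "i \<in> I" "j \<in> I" for i j
    using iid that unfolding iid_Zp_def Z_def[symmetric] I_def[symmetric] by blast
  have rv: "Y i \<in> M \<rightarrow>\<^sub>M Z" if "i \<in> I" for i
    using indep that by (auto simp: indep_vars_def2)
  have F: "F \<in> M \<rightarrow>\<^sub>M P"
    unfolding F_def P_def by (rule measurable_restrict) (rule rv)
  have coord: "(\<lambda>f. f i) \<in> P \<rightarrow>\<^sub>M Z" if "i \<in> I" for i
    unfolding P_def using that by (rule measurable_component_singleton)
  have N: "prob_space N"
    unfolding N_def by (rule prob_space_distr) (rule F)
  interpret N: prob_space N by fact
  have coord': "(\<lambda>f. f i) \<in> N \<rightarrow>\<^sub>M Z" if "i \<in> I" for i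
    using coord[OF that] by (simp add: N_def)
  have law: "distr N Z (\<lambda>f. f i) = distr M Z (Y i)" if "i \<in> I" for i
    unfolding N_def using that
    by (subst distr_distr[OF coord F]) (auto intro!: distr_cong simp: F_def)
  have ne: "I \<noteq> {}" by (auto simp: I_def)
  have "N = PiM I (\<lambda>i. distr M Z (Y i))"
    using indep indep_vars_iff_distr_eq_PiM'[OF ne, of Y "\<lambda>_. Z"] rv
    by (auto simp: N_def P_def F_def)
  also have "\<dots> = PiM I (\<lambda>i. distr N Z (\<lambda>f. f i))"
    by (rule PiM_cong) (auto simp: law)
  finally have prod: "N = PiM I (\<lambda>i. distr N Z (\<lambda>f. f i))" .
  have "distr N P (\<lambda>f. \<lambda>i\<in>I. f i) = distr N N (\<lambda>f. f)"
    by (rule distr_cong)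
       (auto simp: N_def P_def space_PiM PiE_def extensional_restrict)
  then have "distr N P (\<lambda>f. \<lambda>i\<in>I. f i) = PiM I (\<lambda>i. distr N Z (\<lambda>f. f i))"
    using prod by simp
  then have "N.indep_vars (\<lambda>_. Z) (\<lambda>i f. f i) I"
    using N.indep_vars_iff_distr_eq_PiM'[OF ne, of "\<lambda>i f. f i" "\<lambda>_. Z"] coord'
    by (auto simp: P_def)
  then have iidN: "iid_Zp p N {1,2,3} (\<lambda>i f. f i)"
    unfolding iid_Zp_def Z_def[symmetric] I_def[symmetric] using law same by metis
  have transfer: "max_prob p N G = max_prob p M (\<lambda>\<omega>. G (F \<omega>))"
    if G: "G \<in> P \<rightarrow>\<^sub>M count_space UNIV" for G
  proof -
    have "measure N {f \<in> space N. G f = x} = measure M {\<omega> \<in> space M. G (F \<omega>) = x}" for x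
    proof -
      have eq: "{f \<in> space N. G f = x} = G -` {x} \<inter> space P"
        by (auto simp: N_def)
      have s: "G -` {x} \<inter> space P \<in> sets P"
        using G by (rule measurable_sets) simp
      show ?thesis
        using measurable_space[OF F]
        by (auto simp: eq measure_distr[OF F s, folded N_def] intro!: arg_cong[where f = "measure M"])
    qed
    then show ?thesis by (simp add: max_prob_def)
  qed
  have cU: "(\<lambda>f. f i) \<in> P \<rightarrow>\<^sub>M count_space UNIV" if "i \<in> I" for i
  proof -
    have "id \<in> Z \<rightarrow>\<^sub>M count_space UNIV" by (simp add: Z_def)
    from measurable_comp[OF coord[OF that] this] show ?thesis by (simp add: comp_def)
  qed
  have c1: "(\<lambda>f. f 1) \<in> P \<rightarrow>\<^sub>M count_space UNIV"
    and c2: "(\<lambda>f. f 2) \<in> P \<rightarrow>\<^sub>M count_space UNIV"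
    and c3: "(\<lambda>f. f 3) \<in> P \<rightarrow>\<^sub>M count_space UNIV"
    by (auto intro!: cU simp: I_def)
  have FY: "F \<omega> 1 = Y 1 \<omega>" "F \<omega> 2 = Y 2 \<omega>" "F \<omega> 3 = Y 3 \<omega>" for \<omega>
    by (simp_all add: F_def I_def)
  have "max_prob p N (\<lambda>f. f 1) \<le> lam"
    using mx by (simp only: transfer[OF c1] FY)
  have bin: "(\<lambda>f. h (g f) (k f)) \<in> P \<rightarrow>\<^sub>M count_space UNIV"
    if "g \<in> P \<rightarrow>\<^sub>M count_space UNIV" "k \<in> P \<rightarrow>\<^sub>M count_space UNIV"
    for h :: "int \<Rightarrow> int \<Rightarrow> int" and g k
  proof -
    have "(\<lambda>f. h i (k f)) \<in> P \<rightarrow>\<^sub>M count_space UNIV" for i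
      by (rule measurable_compose[OF that(2)]) simp
    from measurable_compose_countable[OF this that(1)] show ?thesis .
  qed
  have c: "(\<lambda>f. f 1 \<oplus>\<^bsub>Zp p\<^esub> f 2 \<oplus>\<^bsub>Zp p\<^esub> f 3) \<in> P \<rightarrow>\<^sub>M count_space UNIV"
    by (rule bin[OF bin[OF c1 c2] c3])
  have "max_prob p N (\<lambda>f. f 1 \<oplus>\<^bsub>Zp p\<^esub> f 2 \<oplus>\<^bsub>Zp p\<^esub> f 3) \<le> C * lam"
    using C[unfolded three_sum_constant_def] lam p N iidN
      \<open>max_prob p N (\<lambda>f. f 1) \<le> lam\<close> by blast
  then show ?thesis
    by (simp only: transfer[OF c] FY)
qed

definition uniform_subset :: "'a set \<Rightarrow> nat \<Rightarrow> 'a set pmf"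
  where "uniform_subset A l = pmf_of_set {X. X \<subseteq> A \<and> card X = l}"

definition max_subset_sum_prob :: "nat \<Rightarrow> int set \<Rightarrow> nat \<Rightarrow> real"
  where "max_subset_sum_prob p A l =
    max_prob p (measure_pmf (uniform_subset A l)) (\<lambda>X. \<Oplus>\<^bsub>Zp p\<^esub>v\<in>X. v)"

end

theory Submission
  imports Defs
begin

text \<open>
  Let \<open>m = 3 ^ k\<close>. Tripling \<open>k\<close> times, the sum of \<open>m\<close> independent uniform samples from a set
  of \<open>N\<close> residues has concentration at most \<open>max (C ^ k / N) \<delta>\<close>; the floor \<open>\<delta> > 2 / p\<close> keeps
  the hypothesis \<open>p > 2 / \<lambda>\<close> of the three-sum bound valid throughout the iteration. The samples
  are distinct with probability at least \<open>1 - m\<^sup>2 / N\<close>, so the same bound holds, up to this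
  factor, for a uniform \<open>m\<close>-subset. A uniform \<open>l\<close>-subset of \<open>A\<close> is a uniform \<open>(l - m)\<close>-subset
  together with a uniform \<open>m\<close>-subset of the remaining \<open>N = n - l + m\<close> elements. Passing to the
  complement if necessary, one has \<open>2 * l \<le> n\<close>, hence \<open>N \<ge> n / 2\<close>. In the second part
  \<open>3 ^ k \<le> l0 < 3 ^ (k + 1)\<close> gives \<open>C ^ k < (3 / l0) powr \<nu>\<close>, and this strict inequality absorbs
  the factor \<open>1 - 2 * m\<^sup>2 / n\<close> for large \<open>n\<close>.
\<close>

section \<open>The three-sum bound for probability mass functions\<close>

text \<open>Three independent copies of \<open>q\<close> are realised as the coordinates of a
  product measure. The result is a bound on every single mass, a form that can be fed back into
  itself.\<close>

lemma three_sum_constant_pmf: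
  fixes q :: "int pmf"
  assumes C: "three_sum_constant C" "0 < C"
    and lam: "0 < lam" "lam \<le> 9/10" and p: "prime p" "real p > 2 / lam"
    and q: "set_pmf q \<subseteq> carrier (Zp p)" "\<And>x. pmf q x \<le> lam"
  shows "pmf (do {x \<leftarrow> q; y \<leftarrow> q; z \<leftarrow> q; return_pmf ((x + y + z) mod int p)}) t \<le> C * lam"
    (is "pmf ?s t \<le> _")
proof -
  interpret residues "int p" "Zp p"
    using prime_gt_1_nat[OF p(1)] by unfold_locales auto
  define I where "I = {1, 2, 3 :: nat}"
  define M where "M = Pi_pmf I 0 (\<lambda>_. q)"
  \<comment> \<open>The space of \<open>M\<close> contains all functions, so without the reduction
    \<open>Y i\<close> would not map into the carrier; on the support of \<open>M\<close> it changes
    nothing.\<close>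
  define Y where "Y = (\<lambda>i (\<omega> :: nat \<Rightarrow> int). \<omega> i mod int p)"
  define K where "K = count_space (carrier (Zp p))"
  have mod: "(\<lambda>x. x mod int p) \<in> count_space UNIV \<rightarrow>\<^sub>M K"
    by (auto simp: K_def)
  have "prob_space.indep_vars (measure_pmf M) (\<lambda>_. K) Y I"
    unfolding Y_def M_def
    by (rule prob_space.indep_vars_compose2[OF measure_pmf.prob_space_axioms indep_vars_Pi_pmf]) (auto simp: I_def K_def)
  moreover have law: "map_pmf (\<lambda>\<omega>. \<omega> i) M = q" if "i \<in> I" for i
    using that by (simp add: M_def I_def Pi_pmf_component)
  have "distr M K (Y i) = distr q K (\<lambda>x. x mod int p)" if "i \<in> I" for i
    unfolding law[OF that, symmetric] Y_def map_pmf_rep_eq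
    by (subst distr_distr[OF mod]) (auto simp: comp_def)
  ultimately have iid: "iid_Zp p M I Y"
    by (simp add: iid_Zp_def K_def)
  have meas: "measure M {\<omega> \<in> space M. f \<omega> = x} = pmf (map_pmf f M) x"
    for f :: "(nat \<Rightarrow> int) \<Rightarrow> int" and x
    by (simp add: pmf_map vimage_def)
  have "map_pmf (Y 1) M = map_pmf (\<lambda>x. x mod int p) (map_pmf (\<lambda>\<omega>. \<omega> 1) M)"
    by (simp add: pmf.map_comp comp_def Y_def)
  also have "\<dots> = map_pmf (\<lambda>x. x mod int p) q"
    using law[of 1] by (simp add: I_def)
  also have "\<dots> = q"
    using q(1) by (intro map_pmf_idI) (auto simp: res_carrier_eq)
  finally have mx: "max_prob p M (Y 1) \<le> lam"
    using q(2) prime_gt_0_nat[OF p(1)] unfolding max_prob_def meas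
    by (subst Max_le_iff) (auto simp: res_carrier_eq)
  have sum: "Y 1 \<omega> \<oplus>\<^bsub>Zp p\<^esub> Y 2 \<omega> \<oplus>\<^bsub>Zp p\<^esub> Y 3 \<omega> = (\<omega> 1 + \<omega> 2 + \<omega> 3) mod int p" for \<omega>
    by (simp add: Y_def res_add_eq mod_simps)
  have s: "map_pmf (\<lambda>\<omega>. (\<omega> 1 + \<omega> 2 + \<omega> 3) mod int p) M = ?s"
    unfolding M_def I_def
    by (simp add: Pi_pmf_insert' map_bind_pmf bind_return_pmf bind_assoc_pmf)
  have "max_prob p M (\<lambda>\<omega>. Y 1 \<omega> \<oplus>\<^bsub>Zp p\<^esub> Y 2 \<omega> \<oplus>\<^bsub>Zp p\<^esub> Y 3 \<omega>) \<le> C * lam"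
    by (rule three_sum_constant_any_space[OF C(1) lam p measure_pmf.prob_space_axioms iid[unfolded I_def] mx])
  then have le: "(MAX x\<in>carrier (Zp p). pmf ?s x) \<le> C * lam"
    unfolding max_prob_def meas sum s .
  show ?thesis
  proof (cases "t \<in> carrier (Zp p)")
    case True
    with le show ?thesis
      by (meson Max_ge finite finite_imageI imageI order_trans)
  next
    \<comment> \<open>The maximum covers only residues; any other \<open>t\<close> has mass
      zero.\<close>
    case False
    then have "t \<notin> set_pmf ?s"
      by auto
    then have "pmf ?s t = 0"
      by (simp only: set_pmf_iff) simp
    then show ?thesis
      using C(2) lam(1) by simp
  qed
qed

section \<open>Iterated tripling of sums of independent samples\<close>

definition sum_pmf :: "nat \<Rightarrow> int set \<Rightarrow> nat \<Rightarrow> int pmf"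
  where "sum_pmf p B m = map_pmf (\<lambda>xs. sum_list xs mod int p) (replicate_pmf m (pmf_of_set B))"

text \<open>The samples split into three independent blocks of length \<open>m\<close>, and each
  block sum may be reduced before the blocks are added.\<close>

lemma sum_pmf_triple:
  "sum_pmf p B (3 * m) =
     do {x \<leftarrow> sum_pmf p B m; y \<leftarrow> sum_pmf p B m; z \<leftarrow> sum_pmf p B m; return_pmf ((x + y + z) mod int p)}"
proof -
  have mod: "(a + (b + c)) mod q = (a mod q + b mod q + c mod q) mod q" for a b c q :: int
    unfolding add.assoc[symmetric] cong_def[symmetric] by (intro cong_add) (auto simp: cong_def)
  have "3 * m = m + (m + m)" by simp
  then show ?thesis
    \<comment> \<open>The local rule \<open>mod\<close> inserts the inner reductions; the deleted
      simp rules would remove them again.\<close>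
    by (simp only: sum_pmf_def replicate_pmf_distrib)
       (simp add: map_pmf_def bind_assoc_pmf bind_return_pmf mod del: mod_add_right_eq mod_add_left_eq mod_add_eq)
qed

text \<open>Induction on the number of triplings: the bound at stage \<open>k\<close> is an
  admissible \<open>lam\<close> for the next stage, being at most 9/10 and at least
  \<open>\<delta>\<close>. Tripling multiplies it by \<open>C\<close>, and
  \<open>C * \<delta> \<le> \<delta>\<close> keeps the floor. With \<open>\<mu>\<close> in place of
  \<open>1 / card B\<close>, one bound serves all large \<open>B\<close> at once.\<close>

lemma pmf_sum_pmf_power3_le:
  assumes C: "three_sum_constant C" "0 < C" "C < 1"
    and p: "prime p" and B: "B \<subseteq> carrier (Zp p)" "finite B" "B \<noteq> {}" "1 / card B \<le> \<mu>"
    and \<mu>: "\<mu> \<le> 9/10" and \<delta>: "0 < \<delta>" "\<delta> \<le> 9/10" "real p > 2 / \<delta>"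
  shows "pmf (sum_pmf p B (3 ^ k)) x \<le> max (C ^ k * \<mu>) \<delta>"
proof (induction k arbitrary: x)
  case 0
  interpret residues "int p" "Zp p"
    using prime_gt_1_nat[OF p(1)] by unfold_locales auto
  have "sum_pmf p B 1 = map_pmf (\<lambda>x. x mod int p) (pmf_of_set B)"
    unfolding sum_pmf_def replicate_pmf_1 by (simp add: pmf.map_comp comp_def)
  also have "\<dots> = pmf_of_set B"
    using B by (intro map_pmf_idI) (auto simp: res_carrier_eq)
  finally have "pmf (sum_pmf p B 1) x \<le> 1 / card B"
    using B by (simp add: indicator_def)
  then show ?case
    using B by simp
next
  case (Suc k)
  interpret residues "int p" "Zp p"
    using prime_gt_1_nat[OF p(1)] by unfold_locales auto
  define lam where "lam = max (C ^ k * \<mu>) \<delta>"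
  have "\<mu> \<ge> 0"
    using B(4) by (rule order_trans[rotated]) simp
  have "C ^ k * \<mu> \<le> 1 * (9/10)"
    using C \<mu> \<open>\<mu> \<ge> 0\<close> by (intro mult_mono power_le_one) auto
  then have lam: "0 < lam" "lam \<le> 9/10"
    using \<delta> by (auto simp: lam_def)
  have "2 / lam \<le> 2 / \<delta>"
    using \<delta> by (intro divide_left_mono) (auto simp: lam_def)
  then have "2 / lam < real p"
    using \<delta> by simp
  moreover have "set_pmf (sum_pmf p B (3 ^ k)) \<subseteq> carrier (Zp p)"
    by (auto simp: sum_pmf_def)
  ultimately have "pmf (sum_pmf p B (3 * 3 ^ k)) x \<le> C * lam"
    unfolding sum_pmf_triple using Suc lam
    by (intro three_sum_constant_pmf[OF C(1,2) lam p]) (auto simp: lam_def)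
  also have "\<dots> \<le> max (C ^ Suc k * \<mu>) \<delta>"
    using C \<delta> mult_left_le_one_le[of \<delta> C]
    by (auto simp: lam_def max_mult_distrib_left mult_ac intro: max.coboundedI2)
  finally show ?case
    by simp
qed

section \<open>From independent samples to subsets of the same size\<close>

lemma pmf_replicate_pmf:
  "pmf (replicate_pmf (length xs) q) xs = prod_list (map (pmf q) xs)"
proof (induction xs)
  case (Cons x xs)
  have "replicate_pmf (length (x # xs)) q
      = map_pmf (\<lambda>(y, ys). y # ys) (pair_pmf q (replicate_pmf (length xs) q))"
    by (simp add: pair_pmf_def map_bind_pmf bind_assoc_pmf bind_return_pmf)
  moreover have "inj (\<lambda>(y, ys :: 'a list). y # ys)"
    by (auto intro: injI)
  then have "pmf (map_pmf (\<lambda>(y, ys). y # ys) (pair_pmf q (replicate_pmf (length xs) q))) (x # xs)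
      = pmf (pair_pmf q (replicate_pmf (length xs) q)) (x, xs)"
    using pmf_map_inj'[of "\<lambda>(y, ys). y # ys" _ "(x, xs)"] by simp
  ultimately show ?case
    using Cons by (simp add: pmf_pair)
qed simp


text \<open>Events become finite sets to be counted, with an integer sum reduced once, so that the
  combinatorics avoids ring sums and measures; \<open>finsum_Zp\<close> translates back.\<close>

definition subsets_with_sum :: "nat \<Rightarrow> int set \<Rightarrow> nat \<Rightarrow> int \<Rightarrow> int set set"
  where "subsets_with_sum p A l x = {X. X \<subseteq> A \<and> card X = l \<and> \<Sum>X mod int p = x}"

lemma finite_subsets_with_sum: "finite A \<Longrightarrow> finite (subsets_with_sum p A l x)"
  by (rule finite_subset[of _ "Pow A"]) (auto simp: subsets_with_sum_def)

text \<open>Each such subset has \<open>fact m\<close> orderings, different subsets have different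
  orderings, and each ordering is sampled with probability \<open>(1 / card B) ^ m\<close>. Lists
  with repetitions are ignored, hence only an inequality.\<close>

lemma card_subsets_with_sum_le_pmf:
  assumes B: "finite B" "B \<noteq> {}"
  shows "fact m * real (card (subsets_with_sum p B m x)) \<le> card B ^ m * pmf (sum_pmf p B m) x"
proof -
  define R where "R = replicate_pmf m (pmf_of_set B)"
  define W where "W = subsets_with_sum p B m x"
  define D where "D = (\<Union>S\<in>W. permutations_of_set S)"
  have W: "finite W" "\<And>S. S \<in> W \<Longrightarrow> finite S \<and> S \<subseteq> B \<and> card S = m \<and> \<Sum>S mod int p = x"
    using B finite_subsets_with_sum[of B p m x]
    by (auto simp: W_def subsets_with_sum_def intro: finite_subset)
  have "card D = (\<Sum>S\<in>W. card (permutations_of_set S))"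
    unfolding D_def using W by (intro card_UN_disjoint) (auto dest: permutations_of_setD)
  also have "\<dots> = (\<Sum>S\<in>W. fact m)"
    using W by (intro sum.cong) auto
  finally have "fact m * card W = card D"
    by simp
  have "pmf R xs = (1 / real (card B)) ^ m" if xs: "xs \<in> D" for xs
  proof -
    obtain S where S: "S \<in> W" "xs \<in> permutations_of_set S"
      using xs by (auto simp: D_def)
    then have "length xs = m" "set xs \<subseteq> B"
      using W(2)[of S] length_finite_permutations_of_set[of xs S] by (auto dest: permutations_of_setD)
    have "map (pmf (pmf_of_set B)) xs = replicate m (1 / real (card B))"
      using \<open>length xs = m\<close> \<open>set xs \<subseteq> B\<close> B by (auto simp: list_eq_iff_nth_eq subset_iff indicator_def)
    then show ?thesis
      using pmf_replicate_pmf[of xs "pmf_of_set B"] by (simp add: R_def \<open>length xs = m\<close> prod_list_replicate)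
  qed
  then have "card D * (1 / real (card B)) ^ m = measure (measure_pmf R) D"
    using W by (simp add: measure_measure_pmf_finite D_def)
  also have "\<dots> \<le> measure (measure_pmf R) ((\<lambda>xs. sum_list xs mod int p) -` {x})"
    using W by (intro measure_pmf.finite_measure_mono)
      (fastforce simp: D_def permutations_of_set_def distinct_sum_list_conv_Sum)+
  also have "\<dots> = pmf (sum_pmf p B m) x"
    by (simp add: sum_pmf_def R_def pmf_map)
  finally have "card D * (1 / real (card B)) ^ m \<le> pmf (sum_pmf p B m) x" .
  moreover have "fact m * real (card W) = card D"
    using \<open>fact m * card W = card D\<close> by (metis of_nat_fact of_nat_mult)
  ultimately show ?thesis
    using B by (simp add: W_def field_simps card_gt_0_iff)
qed

text \<open>After division by \<open>N ^ m\<close> the right side is the probability that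
  \<open>m\<close> samples are distinct, the product of \<open>1 - i / N\<close> over
  \<open>i < m\<close>. The induction rests on
  \<open>m\<^sup>2 + m \<le> (Suc m)\<^sup>2\<close>.\<close>

lemma fact_times_binomial_ge:
  assumes "0 < N" "m \<le> N"
  shows "real N ^ m * (1 - real (m\<^sup>2) / N) \<le> fact m * real (N choose m)"
  using assms(2)
proof (induction m)
  case (Suc m)
  have "(1 - real (m\<^sup>2) / N) * (1 - m / N) = 1 - real ((Suc m)\<^sup>2) / N + (Suc m / N + real (m\<^sup>2) / N * (m / N))"
    using assms(1) by (simp add: field_simps power2_eq_square)
  then have "1 - real ((Suc m)\<^sup>2) / N \<le> (1 - real (m\<^sup>2) / N) * (1 - m / N)"
    by simp
  then have "real N ^ Suc m * (1 - real ((Suc m)\<^sup>2) / N) \<le> real N ^ Suc m * ((1 - real (m\<^sup>2) / N) * (1 - m / N))"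
    by (intro mult_left_mono) auto
  also have "\<dots> = (real N ^ m * (1 - real (m\<^sup>2) / N)) * real (N - m)"
    using assms(1) Suc.prems by (simp add: of_nat_diff field_simps)
  also have "\<dots> \<le> (fact m * real (N choose m)) * real (N - m)"
    using Suc by (intro mult_right_mono) auto
  also have "\<dots> = fact (Suc m) * real (N choose Suc m)"
  proof -
    \<comment> \<open>Both sides equal \<open>N * ((N - 1) choose m)\<close>.\<close>
    have "(N - m) * (N choose m) = Suc m * (N choose Suc m)"
      using binomial_absorb_comp[of N m] Suc_times_binomial[of m "N - 1"] assms(1) by simp
    then have "real (N - m) * real (N choose m) = real (Suc m) * real (N choose Suc m)"
      by (metis of_nat_mult)
    then show ?thesis
      by (simp add: algebra_simps)
  qed
  finally show ?case .
qed simp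

section \<open>From small subsets to subsets of size \<open>l\<close>\<close>

text \<open>Complementation in \<open>A\<close> is injective on subsets of \<open>A\<close> and
  sends a sum \<open>x\<close> to \<open>\<Sum>A - x\<close>.\<close>

lemma card_subsets_with_sum_complement:
  assumes "finite A" "l \<le> card A"
  shows "card (subsets_with_sum p A l x)
    \<le> card (subsets_with_sum p A (card A - l) ((\<Sum>A - x) mod int p))"
proof (rule card_inj_on_le)
  show "inj_on ((-) A) (subsets_with_sum p A l x)"
    by (rule inj_onI) (auto simp: subsets_with_sum_def)
  show "(-) A ` subsets_with_sum p A l x
      \<subseteq> subsets_with_sum p A (card A - l) ((\<Sum>A - x) mod int p)"
    using assms by (auto simp: subsets_with_sum_def card_Diff_subset sum_diff finite_subset mod_simps)
  show "finite (subsets_with_sum p A (card A - l) ((\<Sum>A - x) mod int p))"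
    using assms(1) by (rule finite_subsets_with_sum)
qed

text \<open>Double counting of pairs \<open>(X, S)\<close> with \<open>S\<close> an
  \<open>m\<close>-subset of \<open>X\<close>. Such a pair is determined by \<open>R = X - S\<close>
  and \<open>S\<close>; once \<open>R\<close> is fixed, \<open>S\<close> is an
  \<open>m\<close>-subset of \<open>A - R\<close> with prescribed sum, and \<open>c\<close> bounds
  the number of choices.\<close>

lemma card_subsets_with_sum_le:
  fixes c :: real
  assumes A: "finite A" and ml: "m \<le> l" "l \<le> card A"
    and c: "\<And>B y. B \<subseteq> A \<Longrightarrow> card B = card A - l + m \<Longrightarrow> real (card (subsets_with_sum p B m y)) \<le> c"
  shows "card (subsets_with_sum p A l x) * (l choose m) \<le> (card A choose (l - m)) * c"
proof -
  define W where "W = subsets_with_sum p A l x"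
  define K where "K = {R. R \<subseteq> A \<and> card R = l - m}"
  define V where "V = (\<lambda>R. subsets_with_sum p (A - R) m ((x - \<Sum>R) mod int p))"
  define T where "T = (SIGMA X:W. {S. S \<subseteq> X \<and> card S = m})"
  have W: "finite W" "\<And>X. X \<in> W \<Longrightarrow> finite X \<and> X \<subseteq> A \<and> card X = l \<and> \<Sum>X mod int p = x"
    using A finite_subsets_with_sum[of A p l x]
    by (auto simp: W_def subsets_with_sum_def intro: finite_subset)
  have K: "finite K"
    using A by (simp add: K_def)
  have V: "finite (V R)" for R
    using A by (simp add: V_def finite_subsets_with_sum)
  have "card T = (\<Sum>X\<in>W. card {S. S \<subseteq> X \<and> card S = m})"
    unfolding T_def using W by (intro card_SigmaI) auto
  also have "\<dots> = (\<Sum>X\<in>W. l choose m)"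
    using W by (intro sum.cong) (auto simp: n_subsets)
  finally have "card W * (l choose m) = card T"
    by simp
  also have "card T \<le> card (SIGMA R:K. V R)"
  proof (rule card_inj_on_le)
    show "inj_on (\<lambda>(X, S). (X - S, S)) T"
      by (rule inj_onI) (auto simp: T_def)
    show "(\<lambda>(X, S). (X - S, S)) ` T \<subseteq> (SIGMA R:K. V R)"
    proof clarsimp
      fix X S assume "(X, S) \<in> T"
      then have X: "X \<in> W" and S: "S \<subseteq> X" "card S = m"
        by (auto simp: T_def)
      then have f: "finite X" "finite S" "X \<subseteq> A" "card X = l" "\<Sum>X mod int p = x"
        using W(2)[of X] by (auto intro: finite_subset)
      have "(x - \<Sum>(X - S)) mod int p = (\<Sum>X - \<Sum>(X - S)) mod int p"
        using f by (simp add: mod_simps flip: f(5))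
      also have "\<dots> = \<Sum>S mod int p"
        using S f by (simp add: sum_diff)
      finally show "X - S \<in> K \<and> S \<in> V (X - S)"
        using S f by (auto simp: K_def V_def subsets_with_sum_def card_Diff_subset)
    qed
    show "finite (SIGMA R:K. V R)"
      using K V by blast
  qed
  also have "card (SIGMA R:K. V R) = (\<Sum>R\<in>K. card (V R))"
    using K V by (intro card_SigmaI) auto
  finally have "real (card W * (l choose m)) \<le> real (\<Sum>R\<in>K. card (V R))"
    by (rule of_nat_mono)
  also have "\<dots> \<le> (\<Sum>R\<in>K. c)"
    unfolding of_nat_sum
  proof (rule sum_mono)
    fix R assume "R \<in> K"
    then have "card (A - R) = card A - l + m"
      using A ml by (auto simp: K_def card_Diff_subset finite_subset)
    then show "real (card (V R)) \<le> c"
      unfolding V_def by (intro c) auto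
  qed
  also have "\<dots> = (card A choose (l - m)) * c"
    using A by (simp add: K_def n_subsets)
  finally show ?thesis
    by (simp add: W_def)
qed

text \<open>Sampling bounds the number of choices of \<open>S\<close> by \<open>c\<close>, and the
  distinctness factor turns \<open>N ^ m\<close> into \<open>fact m * (N choose m)\<close>. The
  condition \<open>2 * l \<le> card A\<close> makes every remaining set contain at least half of
  \<open>A\<close>, so that \<open>lam\<close> applies to it.\<close>

lemma card_subsets_with_sum_le_binomial:
  fixes lam :: real
  assumes A: "finite A" and ml: "0 < m" "m \<le> l" "2 * l \<le> card A" "2 * m\<^sup>2 \<le> card A"
    and lam: "\<And>B y. B \<subseteq> A \<Longrightarrow> card A \<le> 2 * card B \<Longrightarrow> pmf (sum_pmf p B m) y \<le> lam"
  shows "card (subsets_with_sum p A l x) * (1 - 2 * real (m\<^sup>2) / card A) \<le> lam * (card A choose l)"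
proof -
  define n where "n = card A"
  define N where "N = n - l + m"
  define c where "c = lam * N ^ m / fact m"
  define d where "d = 1 - 2 * real (m\<^sup>2) / n"
  have N: "0 < N" "m \<le> N" "n \<le> 2 * N" "0 < n" "l \<le> n"
    using ml by (auto simp: N_def n_def)
  have "real (2 * m\<^sup>2) \<le> real n"
    using ml(4) unfolding n_def by (rule of_nat_mono)
  then have d0: "0 \<le> d"
    using N by (simp add: d_def field_simps)
  have "real (m\<^sup>2) / N \<le> 2 * real (m\<^sup>2) / n"
    using N(1,4) mult_right_mono[OF of_nat_mono[OF N(3), where ?'a = real], of "real (m\<^sup>2)"]
    by (simp add: field_simps)
  then have d: "d \<le> 1 - real (m\<^sup>2) / N"
    by (simp add: d_def)
  have "0 \<le> pmf (sum_pmf p A m) 0"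
    by simp
  also have "\<dots> \<le> lam"
    by (rule lam) auto
  finally have "0 \<le> lam" .
  have "real (card (subsets_with_sum p B m y)) \<le> c"
    if B: "B \<subseteq> A" "card B = card A - l + m" for B y
  proof -
    have cB: "card B = N"
      using B by (simp add: N_def n_def)
    then have "finite B" "B \<noteq> {}"
      using N by (auto intro: card_ge_0_finite)
    then have "fact m * real (card (subsets_with_sum p B m y)) \<le> N ^ m * pmf (sum_pmf p B m) y"
      using card_subsets_with_sum_le_pmf[of B m p y] by (simp add: cB)
    also have "\<dots> \<le> N ^ m * lam"
      using N B cB by (intro mult_left_mono lam) (auto simp: n_def)
    finally show ?thesis
      by (simp add: c_def field_simps)
  qed
  then have "card (subsets_with_sum p A l x) * (l choose m) \<le> (n choose (l - m)) * c"
    using card_subsets_with_sum_le[of A m l p c x] A ml by (simp add: n_def)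
  then have "card (subsets_with_sum p A l x) * (l choose m) * d \<le> (n choose (l - m)) * c * d"
    using d0 by (intro mult_right_mono) simp_all
  also have "c * d = lam / fact m * (N ^ m * d)"
    by (simp add: c_def)
  then have "(n choose (l - m)) * c * d = (n choose (l - m)) * (lam / fact m * (N ^ m * d))"
    by (simp add: mult.assoc)
  also have "\<dots> \<le> (n choose (l - m)) * (lam / fact m * (fact m * real (N choose m)))"
  proof (intro mult_left_mono)
    have "real N ^ m * d \<le> real N ^ m * (1 - real (m\<^sup>2) / N)"
      using d by (intro mult_left_mono) auto
    also have "\<dots> \<le> fact m * real (N choose m)"
      by (rule fact_times_binomial_ge) (use N in auto)
    finally show "real (N ^ m) * d \<le> fact m * real (N choose m)"
      by simp
  qed (use \<open>0 \<le> lam\<close> in auto)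
  also have "\<dots> = lam * real ((n choose (l - m)) * (N choose m))"
    by simp
  \<comment> \<open>Both sides count disjoint pairs of sizes \<open>l - m\<close> and
    \<open>m\<close>: one set after the other, or the union first and then its splitting.\<close>
  also have "(n choose (l - m)) * (N choose m) = (n choose l) * (l choose m)"
    using choose_mult[of "l - m" l n] ml N binomial_symmetric[of m l] by (simp add: N_def)
  finally have "card (subsets_with_sum p A l x) * d * (l choose m) \<le> lam * (n choose l) * (l choose m)"
    by (simp add: mult_ac)
  then have "card (subsets_with_sum p A l x) * d \<le> lam * (n choose l)"
    using ml by (simp add: mult_le_cancel_right)
  then show ?thesis
    by (simp add: d_def n_def)
qed

section \<open>From counting back to probabilities\<close>

lemma finsum_Zp:
  assumes "prime p" "finite X" "X \<subseteq> carrier (Zp p)"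
  shows "(\<Oplus>\<^bsub>Zp p\<^esub>v\<in>X. v) = \<Sum>X mod int p"
proof -
  interpret residues "int p" "Zp p"
    using prime_gt_1_nat[OF assms(1)] by unfold_locales auto
  have "(\<Oplus>\<^bsub>Zp p\<^esub>v\<in>X. v) = (\<Oplus>\<^bsub>Zp p\<^esub>v\<in>X. v mod int p)"
    using assms(3) by (intro finsum_cong') (auto simp: res_carrier_eq)
  then show ?thesis
    using sum_cong[OF assms(2)] by simp
qed

text \<open>There are \<open>card A choose l\<close> equally likely subsets. The factor
  \<open>d\<close> stays on the left because the two parts of the theorem absorb it
  differently.\<close>

lemma max_subset_sum_prob_le:
  fixes b d :: real
  assumes p: "prime p" and A: "A \<subseteq> carrier (Zp p)" and l: "l \<le> card A"
    and b: "\<And>x. real (card (subsets_with_sum p A l x)) * d \<le> b * (card A choose l)" and d: "0 < d"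
  shows "max_subset_sum_prob p A l * d \<le> b"
proof -
  interpret residues "int p" "Zp p"
    using prime_gt_1_nat[OF p] by unfold_locales auto
  have fA: "finite A"
    using A by (rule finite_subset) simp
  define U where "U = {X. X \<subseteq> A \<and> card X = l}"
  have cU: "card U = card A choose l"
    using fA by (simp add: U_def n_subsets)
  then have "0 < card U"
    using l by simp
  then have U: "finite U" "U \<noteq> {}" "0 < card U"
    by (auto intro: card_ge_0_finite)
  have "measure (measure_pmf (pmf_of_set U)) {X. (\<Oplus>\<^bsub>Zp p\<^esub>v\<in>X. v) = x} \<le> b / d" for x
  proof -
    have "U \<inter> {X. (\<Oplus>\<^bsub>Zp p\<^esub>v\<in>X. v) = x} = subsets_with_sum p A l x"
      using A fA p by (auto simp: U_def subsets_with_sum_def finsum_Zp finite_subset)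
    then have "measure (measure_pmf (pmf_of_set U)) {X. (\<Oplus>\<^bsub>Zp p\<^esub>v\<in>X. v) = x} = real (card (subsets_with_sum p A l x)) / real (card U)"
      using U by (simp add: measure_pmf_of_set)
    moreover have "real (card (subsets_with_sum p A l x)) \<le> b / d * real (card U)"
      using b[of x] d by (simp add: cU pos_le_divide_eq)
    ultimately show ?thesis
      using U by (simp add: pos_divide_le_eq)
  qed
  then have "max_subset_sum_prob p A l \<le> b / d"
    unfolding max_subset_sum_prob_def max_prob_def uniform_subset_def U_def[symmetric]
    using prime_gt_0_nat[OF p(1)] by (subst Max_le_iff) (auto simp: res_carrier_eq)
  then show ?thesis
    using d by (simp add: field_simps)
qed

lemma max_subset_sum_prob_nonneg:
  assumes "prime p"
  shows "0 \<le> max_subset_sum_prob p A l"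
proof -
  interpret residues "int p" "Zp p"
    using prime_gt_1_nat[OF assms] by unfold_locales auto
  have "0 mod int p \<in> carrier (Zp p)"
    by (rule mod_in_carrier)
  then show ?thesis
    unfolding max_subset_sum_prob_def max_prob_def
    by (subst Max_ge_iff) auto
qed

text \<open>Combines tripling and counting, with \<open>\<mu> = 2 / n\<close> for subsets containing
  at least half of \<open>A\<close>. The floor \<open>\<delta>\<close> stays free, to be matched to
  the lower bound on \<open>p\<close> in each part.\<close>

lemma max_subset_sum_prob_bound:
  fixes m :: nat
  assumes C: "three_sum_constant C" "0 < C" "C < 1"
    and p: "prime p" "A \<subseteq> carrier (Zp p)" and n: "card A = n" "3 \<le> n"
    and m: "m = 3 ^ k" "m \<le> l" "l \<le> n" "m \<le> n - l" "2 * m\<^sup>2 < n"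
    and \<delta>: "0 < \<delta>" "\<delta> \<le> 9/10" "real p > 2 / \<delta>"
  shows "max_subset_sum_prob p A l * (1 - 2 * real (m\<^sup>2) / n) \<le> max (C ^ k * (2 / n)) \<delta>"
proof (rule max_subset_sum_prob_le[OF p])
  show "l \<le> card A"
    using m n by simp
  have "real (2 * m\<^sup>2) < real n"
    using m(5) by (simp only: of_nat_less_iff)
  then show "0 < 1 - 2 * real (m\<^sup>2) / n"
    using n by (simp add: field_simps)
  have fA: "finite A"
    using n by (intro card_ge_0_finite) simp
  have lam: "pmf (sum_pmf p B m) y \<le> max (C ^ k * (2 / n)) \<delta>"
    if B: "B \<subseteq> A" "card A \<le> 2 * card B" for B y
    unfolding m
  proof (rule pmf_sum_pmf_power3_le[OF C p(1)])
    have "0 < card B"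
      using B n by linarith
    then show "finite B" "B \<noteq> {}"
      by (auto intro: card_ge_0_finite)
    have "real n \<le> 2 * real (card B)"
      using of_nat_mono[OF B(2), where ?'a = real] n by simp
    then show "1 / real (card B) \<le> 2 / real n"
      using n \<open>0 < card B\<close> by (simp add: field_simps)
    show "2 / real n \<le> 9 / 10"
      using n by (simp add: field_simps)
  qed (use B p \<delta> in auto)
  show "card (subsets_with_sum p A l x) * (1 - 2 * real (m\<^sup>2) / n) \<le> max (C ^ k * (2 / n)) \<delta> * (card A choose l)" for x
  proof (cases "2 * l \<le> n")
    case True
    then show ?thesis
      using card_subsets_with_sum_le_binomial[OF fA, of m l p "max (C ^ k * (2 / n)) \<delta>" x] lam m n
      by simp
  next
    case False
    \<comment> \<open>Now \<open>n - l\<close> is the small size. The target sum changes to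
      \<open>y\<close>, which is harmless since the bound is uniform in the target.\<close>
    define y where "y = (\<Sum>A - x) mod int p"
    have "card (subsets_with_sum p A l x) * (1 - 2 * real (m\<^sup>2) / n)
        \<le> card (subsets_with_sum p A (n - l) y) * (1 - 2 * real (m\<^sup>2) / n)"
      using card_subsets_with_sum_complement[OF fA, of l p x] n m \<open>0 < 1 - 2 * real (m\<^sup>2) / n\<close>
      by (intro mult_right_mono) (auto simp: y_def)
    also have "\<dots> \<le> max (C ^ k * (2 / n)) \<delta> * (n choose (n - l))"
      using card_subsets_with_sum_le_binomial[OF fA, of m "n - l" p "max (C ^ k * (2 / n)) \<delta>" y]
        lam m n False by simp
    also have "n choose (n - l) = n choose l"
      using binomial_symmetric[OF m(3)] by simp
    finally show ?thesis
      by (simp add: n)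
  qed
qed

section \<open>Choice of the parameters in the two parts\<close>

theorem theorem4p3:
  fixes C3 \<nu> :: real
  assumes "0 < C3" and "C3 < 1" and "three_sum_constant C3"
    and "\<nu> = - log 3 C3"
  shows "(\<forall>\<epsilon>::real. \<epsilon> > 0 \<longrightarrow>
            (\<exists>N::nat. \<forall>(n::nat) (l::nat) (p::nat) (A::int set).
               n > 0 \<longrightarrow> l > 0 \<longrightarrow> n \<ge> N \<longrightarrow> l \<ge> N \<longrightarrow> int n - int l \<ge> int N \<longrightarrow>
               prime p \<longrightarrow> real p > 4 * real n / \<epsilon> \<longrightarrow>
               A \<subseteq> carrier (Zp p) \<longrightarrow> card A = n \<longrightarrow>
               max_subset_sum_prob p A l \<le> \<epsilon> / real n))
       \<and> (\<forall>(l0::nat) (\<epsilon>::real). l0 > 0 \<longrightarrow> \<epsilon> = 2 * (3 / real l0) powr \<nu> \<longrightarrow>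
            (\<exists>N::nat. \<forall>(n::nat) (l::nat) (p::nat) (A::int set).
               n \<ge> N \<longrightarrow> l > l0 \<longrightarrow> int n - int l > int l0 \<longrightarrow>
               prime p \<longrightarrow> p > n ^ 2 \<longrightarrow>
               A \<subseteq> carrier (Zp p) \<longrightarrow> card A = n \<longrightarrow>
               max_subset_sum_prob p A l \<le> \<epsilon> / real n))"
proof (intro conjI allI impI)
  fix \<epsilon> :: real assume \<epsilon>: "0 < \<epsilon>"
  \<comment> \<open>This gives \<open>C3 ^ k * (2 / n) \<le> \<epsilon> / (2 * n)\<close>, half the
    desired bound; the spare factor 2 pays for a distinctness factor of at least 1/2.\<close>
  obtain k where k: "C3 ^ k < \<epsilon> / 4"
    using real_arch_pow_inv[of "\<epsilon> / 4" C3] assms \<epsilon> by auto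
  define m where "m = (3 :: nat) ^ k"
  \<comment> \<open>The summands ensure, in turn, that the floor is at most 1/2, that the
    distinctness factor is at least 1/2, that \<open>m\<close> fits into \<open>l\<close> and
    \<open>n - l\<close>, and that \<open>2 / n \<le> 9 / 10\<close>.\<close>
  define N where "N = nat \<lceil>\<epsilon>\<rceil> + 4 * m\<^sup>2 + m + 3"
  have mpos: "0 < m"
    by (simp add: m_def)
  show "\<exists>N::nat. \<forall>(n::nat) (l::nat) (p::nat) (A::int set).
               n > 0 \<longrightarrow> l > 0 \<longrightarrow> n \<ge> N \<longrightarrow> l \<ge> N \<longrightarrow> int n - int l \<ge> int N \<longrightarrow>
               prime p \<longrightarrow> real p > 4 * real n / \<epsilon> \<longrightarrow>
               A \<subseteq> carrier (Zp p) \<longrightarrow> card A = n \<longrightarrow>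
               max_subset_sum_prob p A l \<le> \<epsilon> / real n"
  proof (rule exI[of _ N], intro allI impI)
    fix n l p :: nat and A :: "int set"
    assume *: "n > 0" "n \<ge> N" "l \<ge> N" "int n - int l \<ge> int N" "prime p"
      "real p > 4 * real n / \<epsilon>" "A \<subseteq> carrier (Zp p)" "card A = n"
    have m4: "4 * m\<^sup>2 \<le> n" and "\<epsilon> \<le> n" and mn: "m \<le> l" "l \<le> n" "m \<le> n - l" "3 \<le> n"
      using * unfolding N_def by linarith+
    then have m2: "2 * m\<^sup>2 < n"
      using mpos * by linarith
    have "C3 ^ k * (2 / n) \<le> \<epsilon> / (2 * n)"
      using k * by (simp add: field_simps)
    \<comment> \<open>With the floor \<open>\<epsilon> / (2 * n)\<close>, the condition
      \<open>p > 2 / \<delta>\<close> is exactly the assumed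
      \<open>p > 4 * n / \<epsilon>\<close>.\<close>
    then have "max_subset_sum_prob p A l * (1 - 2 * real (m\<^sup>2) / n) \<le> \<epsilon> / (2 * n)"
      using max_subset_sum_prob_bound[OF assms(3,1,2) *(5,7,8) mn(4) m_def mn(1-3) m2, of "\<epsilon> / (2 * n)"]
        * \<epsilon> \<open>\<epsilon> \<le> n\<close> by (simp add: max_absorb2 divide_le_eq)
    moreover have "real (4 * m\<^sup>2) \<le> real n"
      using m4 by (rule of_nat_mono)
    then have "1 / 2 \<le> 1 - 2 * real (m\<^sup>2) / n"
      using * by (simp add: field_simps)
    then have "max_subset_sum_prob p A l * (1 / 2) \<le> max_subset_sum_prob p A l * (1 - 2 * real (m\<^sup>2) / n)"
      by (intro mult_left_mono max_subset_sum_prob_nonneg *)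
    ultimately have "max_subset_sum_prob p A l * (1 / 2) \<le> \<epsilon> / (2 * n)"
      by (rule order_trans[rotated])
    then show "max_subset_sum_prob p A l \<le> \<epsilon> / real n"
      by simp
  qed
next
  fix l0 :: nat and \<epsilon> :: real
  assume l0: "0 < l0" and \<epsilon>: "\<epsilon> = 2 * (3 / real l0) powr \<nu>"
  \<comment> \<open>The largest power of three not exceeding \<open>l0\<close>, so that
    \<open>m\<close> fits into \<open>l\<close> and \<open>n - l\<close>.\<close>
  define k where "k = nat \<lfloor>log 3 l0\<rfloor>"
  define m where "m = (3 :: nat) ^ k"
  define t where "t = (3 / real l0) powr \<nu>"
  have "k = \<lfloor>log 3 l0\<rfloor>"
    using l0 by (simp add: k_def)
  then have "real k \<le> log 3 l0" "log 3 l0 < real k + 1"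
    by linarith+
  then have "3 powr real k \<le> real l0" "real l0 < 3 powr (real k + 1)"
    using l0 le_log_iff[of 3 "real l0" "real k"] log_less_iff[of 3 "real l0" "real k + 1"] by auto
  then have "real m \<le> real l0" and l0_less: "real l0 < 3 * 3 ^ k"
    by (simp_all add: m_def powr_add powr_realpow)
  then have m: "m \<le> l0"
    by simp
  have \<nu>: "0 < \<nu>"
    using assms by simp
  have "C3 = 3 powr - \<nu>"
    using assms by simp
  then have "C3 ^ k = (3 powr - \<nu>) powr real k"
    using assms(1) by (simp add: powr_realpow)
  also have "\<dots> = (3 powr - real k) powr \<nu>"
    by (simp add: powr_powr mult.commute)
  also have "3 powr - real k = 1 / (3 :: real) ^ k"
    by (simp add: powr_minus_divide powr_realpow)
  \<comment> \<open>Here \<open>l0 < 3 * 3 ^ k\<close> is read as \<open>1 / 3 ^ k < 3 / l0\<close>.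
    Strictness makes the gap \<open>t - C3 ^ k\<close> positive.\<close>
  also have "(1 / (3 :: real) ^ k) powr \<nu> < t"
    unfolding t_def using l0 l0_less \<nu> by (intro powr_less_mono2) (auto simp: field_simps)
  finally have Ct: "C3 ^ k < t" .
  \<comment> \<open>The first summand is \<open>C3 ^ k \<le> t * d\<close> solved for
    \<open>n\<close>. The second gives \<open>n / C3 ^ k \<le> n\<^sup>2 < p\<close>, the third
    \<open>d > 0\<close>, the last \<open>2 / n \<le> 9 / 10\<close>.\<close>
  define N where "N = nat \<lceil>2 * real (m\<^sup>2) * t / (t - C3 ^ k)\<rceil> + nat \<lceil>1 / C3 ^ k\<rceil> + 2 * m\<^sup>2 + 3"
  show "\<exists>N::nat. \<forall>(n::nat) (l::nat) (p::nat) (A::int set).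
               n \<ge> N \<longrightarrow> l > l0 \<longrightarrow> int n - int l > int l0 \<longrightarrow>
               prime p \<longrightarrow> p > n ^ 2 \<longrightarrow>
               A \<subseteq> carrier (Zp p) \<longrightarrow> card A = n \<longrightarrow>
               max_subset_sum_prob p A l \<le> \<epsilon> / real n"
  proof (rule exI[of _ N], intro allI impI)
    fix n l p :: nat and A :: "int set"
    assume *: "n \<ge> N" "l > l0" "int n - int l > int l0" "prime p" "p > n ^ 2"
      "A \<subseteq> carrier (Zp p)" "card A = n"
    have n: "2 * real (m\<^sup>2) * t / (t - C3 ^ k) \<le> n" "1 / C3 ^ k \<le> n" "2 * m\<^sup>2 < n" "3 \<le> n"
      using * unfolding N_def by linarith+
    define d where "d = 1 - 2 * real (m\<^sup>2) / n"
    have "real (2 * m\<^sup>2) < real n"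
      using n(3) by (simp only: of_nat_less_iff)
    then have d: "0 < d"
      using n by (simp add: d_def field_simps)
    \<comment> \<open>The floor is set equal to the main term, so that the maximum
      collapses.\<close>
    define \<delta> where "\<delta> = C3 ^ k * (2 / n)"
    have \<delta>: "0 < \<delta>" "\<delta> \<le> 9 / 10"
    proof -
      show "0 < \<delta>"
        using assms n by (simp add: \<delta>_def)
      have "\<delta> \<le> 1 * (2 / n)"
        unfolding \<delta>_def using assms by (intro mult_right_mono power_le_one) auto
      also have "\<dots> \<le> 9 / 10"
        using n by (simp add: field_simps)
      finally show "\<delta> \<le> 9 / 10" .
    qed
    have "2 / \<delta> = n * (1 / C3 ^ k)"
      by (simp add: \<delta>_def)
    also have "\<dots> \<le> real n * n"
      using n by (intro mult_left_mono) auto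
    also have "\<dots> = real (n\<^sup>2)"
      by (simp add: power2_eq_square)
    also have "\<dots> < real p"
      using * by (simp only: of_nat_less_iff)
    finally have "max_subset_sum_prob p A l * d \<le> max \<delta> \<delta>"
      unfolding d_def \<delta>_def using max_subset_sum_prob_bound[OF assms(3,1,2) *(4,6,7) _ m_def, of l \<delta>]
        * m n \<delta> by (simp add: \<delta>_def)
    also have "max \<delta> \<delta> \<le> (2 * t / n) * d"
    proof -
      have "2 * real (m\<^sup>2) * t \<le> n * (t - C3 ^ k)"
        using n(1) Ct by (simp add: field_simps)
      then have "C3 ^ k \<le> t * d"
        using n by (simp add: d_def field_simps)
      then show ?thesis
        using n by (simp add: \<delta>_def field_simps)
    qed
    finally have "max_subset_sum_prob p A l \<le> 2 * t / n"
      by (rule mult_right_le_imp_le) (rule d)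
    then show "max_subset_sum_prob p A l \<le> \<epsilon> / real n"
      by (simp add: \<epsilon> t_def)
  qed
qed

end
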